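(* Let $\phi$ be a partial flow on a metric space $X$. Every isolated set $\Lambda$ of $\phi$ admits a catenary pseudo-metric. If $\Lambda$ is a singleton, it admits a catenary metric.
   Context: A partial flow on a metric space $X$ is a continuous map $\phi\colon\Gamma\to X$ on an open set $\Gamma\subset\mathbb{R}\times X$. Here $\Gamma_x=\{t:(t,x)\in\Gamma\}$ is a connected set containing $0$, $\Gamma_{\phi_t(x)}=\Gamma_x-t$, $\phi_0=\mathrm{id}$, and $\phi_s\phi_t=\phi_{s+t}$ where defined. A $\phi$-invariant set $\Lambda$ is isolated if there is a compact neighborhood $N$ (an isolating neighborhood) such that $\phi_{\Gamma_x}(x)\subseteq N$ implies $x\in\Lambda$. For a function $F$ on $N\times N$, $\dot F(x,y)=\frac{d}{dt}\big|_{t=0}F(\phi_t(x),\phi_t(y))$ and $\ddot F=(\dot F)^{\cdot}$. A catenary pseudo-metric for $\Lambda$ is a continuous pseudo-metric $\mathrm d\colon N\times N\to\mathbb{R}$ on an isolating neighborhood $N$ of $\Lambda$ such that $\ddot{\mathrm d}=\mathrm d$, and $\mathrm d(x,y)=0$ if and only if $x=y$ or $x,y\in\Lambda$. If in addition $\mathrm d(x,y)=0$ implies $x=y$, it is a catenary metric. *)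

theory Defs
  imports "HOL-Analysis.Analysis"
begin

text \<open>A partial flow on the metric space X (modelled as the type 'a) is given by
  its domain Gamma, a subset of R x X, and the map phi, written curried.\<close>

definition flow_dom :: "(real \<times> 'a) set \<Rightarrow> 'a \<Rightarrow> real set" where
  "flow_dom \<Gamma> x = {t. (t, x) \<in> \<Gamma>}"

definition partial_flow :: "(real \<times> 'a::metric_space) set \<Rightarrow> (real \<Rightarrow> 'a \<Rightarrow> 'a) \<Rightarrow> bool" where
  "partial_flow \<Gamma> \<phi> \<longleftrightarrow>
     open \<Gamma> \<and>
     continuous_on \<Gamma> (\<lambda>(t, x). \<phi> t x) \<and>
     (\<forall>x. connected (flow_dom \<Gamma> x) \<and> 0 \<in> flow_dom \<Gamma> x) \<and>
     (\<forall>x t. t \<in> flow_dom \<Gamma> x \<longrightarrow> flow_dom \<Gamma> (\<phi> t x) = (\<lambda>s. s - t) ` flow_dom \<Gamma> x) \<and>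
     (\<forall>x. \<phi> 0 x = x) \<and>
     (\<forall>x t s. t \<in> flow_dom \<Gamma> x \<and> s \<in> flow_dom \<Gamma> (\<phi> t x) \<longrightarrow> \<phi> s (\<phi> t x) = \<phi> (s + t) x)"

definition flow_invariant :: "(real \<times> 'a) set \<Rightarrow> (real \<Rightarrow> 'a \<Rightarrow> 'a) \<Rightarrow> 'a set \<Rightarrow> bool" where
  "flow_invariant \<Gamma> \<phi> \<Lambda> \<longleftrightarrow> (\<forall>x\<in>\<Lambda>. \<forall>t\<in>flow_dom \<Gamma> x. \<phi> t x \<in> \<Lambda>)"

definition isolating_nbhd :: "(real \<times> 'a::metric_space) set \<Rightarrow> (real \<Rightarrow> 'a \<Rightarrow> 'a) \<Rightarrow> 'a set \<Rightarrow> 'a set \<Rightarrow> bool" where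
  "isolating_nbhd \<Gamma> \<phi> \<Lambda> N \<longleftrightarrow>
     compact N \<and> \<Lambda> \<subseteq> interior N \<and>
     (\<forall>x. (\<lambda>t. \<phi> t x) ` flow_dom \<Gamma> x \<subseteq> N \<longrightarrow> x \<in> \<Lambda>)"

definition isolated_set :: "(real \<times> 'a::metric_space) set \<Rightarrow> (real \<Rightarrow> 'a \<Rightarrow> 'a) \<Rightarrow> 'a set \<Rightarrow> bool" where
  "isolated_set \<Gamma> \<phi> \<Lambda> \<longleftrightarrow> flow_invariant \<Gamma> \<phi> \<Lambda> \<and> (\<exists>N. isolating_nbhd \<Gamma> \<phi> \<Lambda> N)"

definition has_flow_deriv :: "(real \<times> 'a) set \<Rightarrow> (real \<Rightarrow> 'a \<Rightarrow> 'a) \<Rightarrow> 'a set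
    \<Rightarrow> ('a \<Rightarrow> 'a \<Rightarrow> real) \<Rightarrow> ('a \<Rightarrow> 'a \<Rightarrow> real) \<Rightarrow> bool" where
  "has_flow_deriv \<Gamma> \<phi> N F F' \<longleftrightarrow>
     (\<forall>x\<in>N. \<forall>y\<in>N.
        ((\<lambda>t. F (\<phi> t x) (\<phi> t y)) has_real_derivative F' x y)
          (at 0 within {t. t \<in> flow_dom \<Gamma> x \<and> t \<in> flow_dom \<Gamma> y \<and> \<phi> t x \<in> N \<and> \<phi> t y \<in> N}))"

definition pseudo_metric_on :: "'a set \<Rightarrow> ('a \<Rightarrow> 'a \<Rightarrow> real) \<Rightarrow> bool" where
  "pseudo_metric_on N d \<longleftrightarrow>
     (\<forall>x\<in>N. d x x = 0) \<and>
     (\<forall>x\<in>N. \<forall>y\<in>N. d x y = d y x) \<and>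
     (\<forall>x\<in>N. \<forall>y\<in>N. \<forall>z\<in>N. d x z \<le> d x y + d y z)"

definition catenary_pseudo_metric :: "(real \<times> 'a::metric_space) set \<Rightarrow> (real \<Rightarrow> 'a \<Rightarrow> 'a) \<Rightarrow> 'a set
    \<Rightarrow> 'a set \<Rightarrow> ('a \<Rightarrow> 'a \<Rightarrow> real) \<Rightarrow> bool" where
  "catenary_pseudo_metric \<Gamma> \<phi> \<Lambda> N d \<longleftrightarrow>
     isolating_nbhd \<Gamma> \<phi> \<Lambda> N \<and>
     pseudo_metric_on N d \<and>
     continuous_on (N \<times> N) (\<lambda>(x, y). d x y) \<and>
     (\<exists>d'. has_flow_deriv \<Gamma> \<phi> N d d' \<and> has_flow_deriv \<Gamma> \<phi> N d' d) \<and>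
     (\<forall>x\<in>N. \<forall>y\<in>N. d x y = 0 \<longleftrightarrow> x = y \<or> (x \<in> \<Lambda> \<and> y \<in> \<Lambda>))"

definition catenary_metric :: "(real \<times> 'a::metric_space) set \<Rightarrow> (real \<Rightarrow> 'a \<Rightarrow> 'a) \<Rightarrow> 'a set
    \<Rightarrow> 'a set \<Rightarrow> ('a \<Rightarrow> 'a \<Rightarrow> real) \<Rightarrow> bool" where
  "catenary_metric \<Gamma> \<phi> \<Lambda> N d \<longleftrightarrow>
     catenary_pseudo_metric \<Gamma> \<phi> \<Lambda> N d \<and>
     (\<forall>x\<in>N. \<forall>y\<in>N. d x y = 0 \<longrightarrow> x = y)"

end

theory Submission
  imports Defs
begin

text \<open>
  Let \<open>w\<close> be the distance to \<open>\<Lambda>\<close>, and choose levels \<open>\<epsilon> < lo < hi\<close> of \<open>w\<close> with \<open>{w \<le> hi}\<close> compact and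
  isolating; put \<open>N = {w \<le> \<epsilon>}\<close>. For a point \<open>q\<close> and a scale \<open>\<delta>\<close> let \<open>f(x)\<close> be the supremum of
  \<open>exp (- s) * a\<close>, where \<open>a\<close> measures how far \<open>\<phi>\<^sub>s x\<close> lies inside the region \<open>{w > lo} \<inter> ball q \<delta>\<close>
  while the orbit up to time \<open>s\<close> remains inside \<open>{w < lo + \<delta>}\<close>. Nothing is collected before the
  orbit leaves \<open>{w \<le> lo}\<close>, so \<open>f (\<phi>\<^sub>t x) = exp t * f x\<close> near \<open>N\<close>. The supremum \<open>D\<^sup>+\<close> of
  \<open>\<bar>f x - f y\<bar>\<close> over all \<open>q\<close> and \<open>\<delta>\<close> is then a continuous pseudo-metric expanded by \<open>exp t\<close>. As
  \<open>\<delta> \<rightarrow> 0\<close>, the values \<open>f x\<close> reveal the point where and the time when the orbit of \<open>x\<close> first leaves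
  \<open>{w \<le> lo}\<close>, hence \<open>x\<close> itself. The reversed flow gives a pseudo-metric \<open>D\<^sup>-\<close> contracted by
  \<open>exp (- t)\<close>, so \<open>d = D\<^sup>+ + D\<^sup>-\<close> satisfies \<open>d'' = d\<close>, and every point outside \<open>\<Lambda>\<close> leaves in one of
  the two time directions.
\<close>

section \<open>Elementary properties of partial flows\<close>

locale part_flow =
  fixes \<Gamma> :: "(real \<times> 'a::metric_space) set" and \<phi> :: "real \<Rightarrow> 'a \<Rightarrow> 'a"
  assumes flow: "partial_flow \<Gamma> \<phi>"
begin

lemma open_Gamma: "open \<Gamma>"
  and cont: "continuous_on \<Gamma> (\<lambda>(t, x). \<phi> t x)"
  and flow_zero [simp]: "\<phi> 0 x = x"
  and zero_dom [simp]: "0 \<in> flow_dom \<Gamma> x"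
  and connected_dom: "connected (flow_dom \<Gamma> x)"
  using flow by (auto simp: partial_flow_def)

lemma dom_interval:
  assumes "s \<in> flow_dom \<Gamma> x" "t \<in> flow_dom \<Gamma> x" "s \<le> r" "r \<le> t"
  shows "r \<in> flow_dom \<Gamma> x"
  using connected_contains_Icc[OF connected_dom assms(1,2)] assms(3,4) by auto

lemma dom_flow:
  assumes "t \<in> flow_dom \<Gamma> x"
  shows "s \<in> flow_dom \<Gamma> (\<phi> t x) \<longleftrightarrow> s + t \<in> flow_dom \<Gamma> x"
proof -
  have "flow_dom \<Gamma> (\<phi> t x) = (\<lambda>s. s - t) ` flow_dom \<Gamma> x"
    using flow assms by (auto simp: partial_flow_def)
  then show ?thesis by (auto simp: image_iff) (metis add_diff_cancel_right')
qed

lemma flow_flow: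
  assumes "t \<in> flow_dom \<Gamma> x" "s + t \<in> flow_dom \<Gamma> x"
  shows "\<phi> s (\<phi> t x) = \<phi> (s + t) x"
  using flow assms dom_flow[OF assms(1)] by (auto simp: partial_flow_def)

lemma flow_back:
  assumes "t \<in> flow_dom \<Gamma> x"
  shows "\<phi> (- t) (\<phi> t x) = x"
  using flow_flow[OF assms, of "- t"] by simp

lemma open_dom: "open (flow_dom \<Gamma> x)"
proof -
  have "flow_dom \<Gamma> x = (\<lambda>t. (t, x)) -` \<Gamma>" by (auto simp: flow_dom_def)
  moreover have "open ((\<lambda>t. (t, x)) -` \<Gamma>)"
    by (intro continuous_open_vimage open_Gamma continuous_intros)
  ultimately show ?thesis by simp
qed

lemma orbit_cont: "continuous_on (flow_dom \<Gamma> x) (\<lambda>t. \<phi> t x)"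
proof -
  have "continuous_on (flow_dom \<Gamma> x) (\<lambda>t. (\<lambda>(t, x). \<phi> t x) (t, x))"
    by (rule continuous_on_compose2[OF cont]) (auto simp: flow_dom_def intro!: continuous_intros)
  then show ?thesis by simp
qed

lemma time_slice_cont: "continuous_on {x. t \<in> flow_dom \<Gamma> x} (\<phi> t)"
proof -
  have "continuous_on {x. t \<in> flow_dom \<Gamma> x} (\<lambda>x. (\<lambda>(t, x). \<phi> t x) (t, x))"
    by (rule continuous_on_compose2[OF cont]) (auto simp: flow_dom_def intro!: continuous_intros)
  then show ?thesis by simp
qed

lemma orbit_in_open:
  assumes "open U" "x \<in> U"
  shows "\<exists>\<tau>>0. \<forall>t. \<bar>t\<bar> < \<tau> \<longrightarrow> t \<in> flow_dom \<Gamma> x \<and> \<phi> t x \<in> U"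
proof -
  have "open (flow_dom \<Gamma> x \<inter> (\<lambda>t. \<phi> t x) -` U)"
    using orbit_cont open_dom assms(1) continuous_on_open_vimage by (metis Int_commute)
  moreover have "0 \<in> flow_dom \<Gamma> x \<inter> (\<lambda>t. \<phi> t x) -` U" using assms by simp
  ultimately obtain e where "e > 0" "ball 0 e \<subseteq> flow_dom \<Gamma> x \<inter> (\<lambda>t. \<phi> t x) -` U"
    using openE by blast
  then show ?thesis by (intro exI[of _ e]) (auto simp: subset_iff dist_real_def)
qed

text \<open>The pairs \<open>(r, y)\<close> at which both orbits are defined and less than
  \<open>\<eta>\<close> apart form an open set. It contains the compact segment
  \<open>{0..\<sigma>} \<times> {x}\<close>, hence also a uniform neighbourhood of it.\<close>

lemma flow_tube:
  assumes "\<sigma> \<in> flow_dom \<Gamma> x" "0 \<le> \<sigma>" "0 < \<eta>"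
  shows "\<exists>e>0. \<forall>y. dist x y < e \<longrightarrow>
           (\<forall>r\<in>{0..\<sigma>}. r \<in> flow_dom \<Gamma> y \<and> dist (\<phi> r x) (\<phi> r y) < \<eta>)"
proof -
  let ?D = "\<Gamma> \<inter> flow_dom \<Gamma> x \<times> UNIV"
  define h where "h = (\<lambda>p. dist (\<phi> (fst p) x) (\<phi> (fst p) (snd p)))"
  have D: "open ?D" by (intro open_Int open_Gamma open_Times open_dom open_UNIV)
  have c1: "continuous_on ?D (\<lambda>p. \<phi> (fst p) x)"
    by (rule continuous_on_compose2[OF orbit_cont]) (auto intro!: continuous_intros)
  have c2: "continuous_on ?D (\<lambda>p. \<phi> (fst p) (snd p))"
    using continuous_on_subset[OF cont, of ?D] by (simp add: case_prod_beta')
  have "continuous_on ?D h" unfolding h_def by (intro continuous_on_dist c1 c2)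
  then have W: "open (h -` {..<\<eta>} \<inter> ?D)"
    using D continuous_on_open_vimage open_lessThan by blast
  have "{0..\<sigma>} \<times> {x} \<subseteq> h -` {..<\<eta>} \<inter> ?D"
    using dom_interval[OF zero_dom assms(1)] assms(3) by (auto simp: h_def flow_dom_def)
  moreover have "compact ({0..\<sigma>} \<times> {x})" by (intro compact_Times) auto
  ultimately obtain e where e: "e > 0" "(\<Union>p\<in>{0..\<sigma>} \<times> {x}. ball p e) \<subseteq> h -` {..<\<eta>} \<inter> ?D"
    using compact_subset_open_imp_ball_epsilon_subset W by metis
  show ?thesis
  proof (intro exI[of _ e] conjI e allI impI ballI)
    fix y r assume "dist x y < e" "r \<in> {0..\<sigma>}"
    then have "(r, y) \<in> ball (r, x) e" "(r, x) \<in> {0..\<sigma>} \<times> {x}"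
      by (auto simp: dist_Pair_Pair)
    then have "(r, y) \<in> (\<Union>p\<in>{0..\<sigma>} \<times> {x}. ball p e)" by blast
    then have "(r, y) \<in> h -` {..<\<eta>} \<inter> ?D" using e by blast
    then show "r \<in> flow_dom \<Gamma> y" "dist (\<phi> r x) (\<phi> r y) < \<eta>"
      by (auto simp: h_def flow_dom_def)
  qed
qed

text \<open>Compactness of \<open>{0} \<times> K\<close> inside the open set \<open>\<Gamma>\<close>
  yields one step length that is admissible at every point of \<open>K\<close>. An orbit that never
  leaves \<open>K\<close> can therefore be continued by this step again and again, past any bound
  \<open>S\<close>.\<close>

lemma leaves_compact_or_lasts:
  assumes "compact K"
  shows "\<exists>\<sigma>\<ge>0. \<sigma> \<in> flow_dom \<Gamma> x \<and> (S \<le> \<sigma> \<or> \<phi> \<sigma> x \<notin> K)"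
proof (rule ccontr)
  assume "\<not> ?thesis"
  then have *: "\<sigma> < S \<and> \<phi> \<sigma> x \<in> K" if "\<sigma> \<in> flow_dom \<Gamma> x" "0 \<le> \<sigma>" for \<sigma>
    using that by force
  have "compact ({0} \<times> K)" by (intro compact_Times assms) auto
  moreover have "{0} \<times> K \<subseteq> \<Gamma>" using zero_dom by (auto simp: flow_dom_def)
  ultimately obtain e where e: "e > 0" "(\<Union>p\<in>{0} \<times> K. ball p e) \<subseteq> \<Gamma>"
    using compact_subset_open_imp_ball_epsilon_subset open_Gamma by metis
  have step: "e / 2 \<in> flow_dom \<Gamma> z" if "z \<in> K" for z
  proof -
    have "(e / 2, z) \<in> ball (0, z) e" using e by (simp add: dist_Pair_Pair dist_real_def)
    then have "(e / 2, z) \<in> (\<Union>p\<in>{0} \<times> K. ball p e)" using that by blast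
    then have "(e / 2, z) \<in> \<Gamma>" using e by blast
    then show ?thesis by (simp add: flow_dom_def)
  qed
  have multiples: "real n * (e / 2) \<in> flow_dom \<Gamma> x" for n
  proof (induction n)
    case (Suc n)
    then have "e / 2 \<in> flow_dom \<Gamma> (\<phi> (real n * (e / 2)) x)" using e * step by simp
    then have "e / 2 + real n * (e / 2) \<in> flow_dom \<Gamma> x" using dom_flow[OF Suc] by blast
    moreover have "real (Suc n) * (e / 2) = e / 2 + real n * (e / 2)" by (simp add: algebra_simps)
    ultimately show ?case by metis
  qed simp
  have "real n * (e / 2) < S" for n using *[OF multiples] e by simp
  moreover obtain n where "S < real n * (e / 2)" using e reals_Archimedean3[of "e / 2"] by (meson half_gt_zero)
  ultimately show False by (meson less_asym)
qed

text \<open>Allows everything proved about forward exits to be reused for backward exits.\<close>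

lemma reversed: "part_flow {(t, x). (- t, x) \<in> \<Gamma>} (\<lambda>t. \<phi> (- t))"
proof
  have d: "flow_dom {(t, x). (- t, x) \<in> \<Gamma>} x = uminus ` flow_dom \<Gamma> x" for x
    by (force simp: flow_dom_def)
  have di: "t \<in> uminus ` flow_dom \<Gamma> x \<longleftrightarrow> - t \<in> flow_dom \<Gamma> x" for t x
    by force
  have eq: "{(t, x). (- t, x) \<in> \<Gamma>} = (\<lambda>p. (- fst p, snd p)) -` \<Gamma>" by auto
  have "open ((\<lambda>p. (- fst p, snd p)) -` \<Gamma>)"
    by (intro continuous_open_vimage open_Gamma continuous_intros)
  moreover have "continuous_on ((\<lambda>p. (- fst p, snd p)) -` \<Gamma>)
      (\<lambda>p. (\<lambda>(t, x). \<phi> t x) (- fst p, snd p))"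
    by (rule continuous_on_compose2[OF cont]) (auto intro!: continuous_intros)
  moreover have "connected (uminus ` flow_dom \<Gamma> x)" for x
    by (intro connected_continuous_image connected_dom continuous_intros)
  moreover have "uminus ` flow_dom \<Gamma> (\<phi> (- t) x) = (\<lambda>s. s - t) ` uminus ` flow_dom \<Gamma> x"
    if "- t \<in> flow_dom \<Gamma> x" for t x
  proof (rule set_eqI)
    fix r
    have "r \<in> (\<lambda>s. s - t) ` A \<longleftrightarrow> r + t \<in> A" for A
      by (auto simp: image_iff) (metis add_diff_cancel_right')
    then show "r \<in> uminus ` flow_dom \<Gamma> (\<phi> (- t) x) \<longleftrightarrow>
        r \<in> (\<lambda>s. s - t) ` uminus ` flow_dom \<Gamma> x"
      using dom_flow[OF that, of "- r"] by (simp add: di algebra_simps)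
  qed
  moreover have "\<phi> (- s) (\<phi> (- t) x) = \<phi> (- (s + t)) x"
    if "- t \<in> flow_dom \<Gamma> x" "- s \<in> flow_dom \<Gamma> (\<phi> (- t) x)" for s t x
    using flow_flow[OF that(1)] dom_flow[OF that(1)] that(2) by (simp add: algebra_simps)
  ultimately show "partial_flow {(t, x). (- t, x) \<in> \<Gamma>} (\<lambda>t. \<phi> (- t))"
    unfolding partial_flow_def d di unfolding eq by (auto simp: case_prod_beta' di)
qed

end

section \<open>Exit values, their stability and their growth along the flow\<close>

locale flow_exit = part_flow \<Gamma> \<phi>
  for \<Gamma> :: "(real \<times> 'a::metric_space) set" and \<phi> :: "real \<Rightarrow> 'a \<Rightarrow> 'a" +
  fixes w :: "'a \<Rightarrow> real" and lo hi :: real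
  assumes w_lipschitz: "\<bar>w x - w y\<bar> \<le> dist x y"
    and lo_less_hi: "lo < hi"
    and compact_sublevel: "compact {x. w x \<le> hi}"
begin

text \<open>The number \<open>a\<close> is one common margin by which all the open conditions hold:
  being in the ball around \<open>q\<close>, above \<open>lo\<close>, and below the ceiling
  \<open>lo + \<delta>\<close> up to time \<open>s\<close>. Each condition is 1-Lipschitz in the
  points of the orbit, so an error of \<open>\<eta>\<close> costs only \<open>\<eta>\<close> of
  margin.\<close>

definition probe :: "'a \<Rightarrow> real \<Rightarrow> 'a \<Rightarrow> real \<Rightarrow> real \<Rightarrow> bool" where
  "probe q \<delta> x s a \<longleftrightarrow> 0 \<le> s \<and> 0 < a \<and> s \<in> flow_dom \<Gamma> x \<and>
     dist q (\<phi> s x) + a \<le> \<delta> \<and> lo + a \<le> w (\<phi> s x) \<and> (\<forall>r\<in>{0..s}. w (\<phi> r x) + a \<le> lo + \<delta>)"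

text \<open>The inserted 0 is the value of a point without probes, such as one whose forward orbit
  stays in \<open>{w \<le> lo}\<close>.\<close>

definition exit_value :: "'a \<Rightarrow> real \<Rightarrow> 'a \<Rightarrow> real" where
  "exit_value q \<delta> x = Sup (insert 0 {exp (- s) * a | s a. probe q \<delta> x s a})"

text \<open>The bound \<open>\<delta> \<le> hi - lo\<close> keeps the ceiling
  \<open>lo + \<delta>\<close> within the compact sublevel of \<open>hi\<close> and makes the
  supremum finite.\<close>

definition exit_dist :: "'a \<Rightarrow> 'a \<Rightarrow> real" where
  "exit_dist x y =
     (SUP (q, \<delta>) \<in> UNIV \<times> {0<..hi - lo}. \<bar>exit_value q \<delta> x - exit_value q \<delta> y\<bar>)"

lemma w_cont: "continuous_on A w"
  unfolding continuous_on_iff dist_real_def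
  by (meson w_lipschitz le_less_trans)

lemma probe_le:
  assumes "probe q \<delta> x s a"
  shows "exp (- s) * a \<le> \<delta>"
proof -
  have "0 \<le> s" "0 < a" "dist q (\<phi> s x) + a \<le> \<delta>" using assms by (auto simp: probe_def)
  then have "exp (- s) * a \<le> 1 * a" by (intro mult_right_mono) auto
  moreover have "a \<le> \<delta>"
    using \<open>dist q (\<phi> s x) + a \<le> \<delta>\<close> zero_le_dist[of q "\<phi> s x"] by linarith
  ultimately show ?thesis by linarith
qed

lemma bdd_probe: "bdd_above (insert 0 {exp (- s) * a | s a. probe q \<delta> x s a})"
  by (rule bdd_aboveI[of _ "max 0 \<delta>"]) (auto dest: probe_le simp: le_max_iff_disj)

lemma exit_value_nonneg: "0 \<le> exit_value q \<delta> x"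
  unfolding exit_value_def by (intro cSup_upper bdd_probe) auto

lemma exit_value_ge: "probe q \<delta> x s a \<Longrightarrow> exp (- s) * a \<le> exit_value q \<delta> x"
  unfolding exit_value_def by (intro cSup_upper bdd_probe) auto

lemma exit_value_le:
  assumes "0 \<le> B" "\<And>s a. probe q \<delta> x s a \<Longrightarrow> exp (- s) * a \<le> B"
  shows "exit_value q \<delta> x \<le> B"
  unfolding exit_value_def using assms by (intro cSup_least) auto

lemma exit_value_pos:
  assumes "probe q \<delta> x s a"
  shows "0 < exit_value q \<delta> x"
proof -
  have "0 < exp (- s) * a" using assms by (auto simp: probe_def)
  then show ?thesis using exit_value_ge[OF assms] by linarith
qed

lemma probe_of_exit_value_pos:
  assumes "0 < exit_value q \<delta> x"
  obtains s a where "probe q \<delta> x s a"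
  using assms exit_value_le[of 0 q \<delta> x] by force

lemma probe_perturb:
  assumes p: "probe q \<delta> x s a" and "\<eta> < a"
    and near: "\<And>r. 0 \<le> r \<Longrightarrow> r \<le> s \<Longrightarrow> r \<in> flow_dom \<Gamma> y \<and> dist (\<phi> r x) (\<phi> r y) \<le> \<eta>"
  shows "probe q \<delta> y s (a - \<eta>)"
  unfolding probe_def
proof (intro conjI ballI)
  have s: "0 \<le> s" "dist q (\<phi> s x) + a \<le> \<delta>" "lo + a \<le> w (\<phi> s x)"
    using p by (auto simp: probe_def)
  have ws: "\<bar>w (\<phi> r x) - w (\<phi> r y)\<bar> \<le> \<eta>" if "0 \<le> r" "r \<le> s" for r
    using near[OF that] w_lipschitz[of "\<phi> r x" "\<phi> r y"] by linarith
  show "0 \<le> s" "0 < a - \<eta>" "s \<in> flow_dom \<Gamma> y" using s assms(2) near by auto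
  show "dist q (\<phi> s y) + (a - \<eta>) \<le> \<delta>"
    using s near[of s] dist_triangle[of q "\<phi> s y" "\<phi> s x"] by auto
  show "lo + (a - \<eta>) \<le> w (\<phi> s y)" using s ws[of s] by auto
  show "w (\<phi> r y) + (a - \<eta>) \<le> lo + \<delta>" if "r \<in> {0..s}" for r
    using p ws[of r] that by (force simp: probe_def)
qed

text \<open>Probes worth at most \<open>\<eta>\<close> are covered by the error term, so only the
  others have to be transferred to \<open>y\<close>. Their loss is
  \<open>exp (- s) * \<eta> \<le> \<eta>\<close>.\<close>

lemma exit_value_mono_perturb:
  assumes "0 \<le> \<eta>"
    and "\<And>s a. probe q \<delta> x s a \<Longrightarrow> \<eta> < exp (- s) * a \<Longrightarrow> \<eta> < a \<Longrightarrow> probe q \<delta> y s (a - \<eta>)"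
  shows "exit_value q \<delta> x \<le> exit_value q \<delta> y + \<eta>"
proof (rule exit_value_le)
  show "0 \<le> exit_value q \<delta> y + \<eta>" using exit_value_nonneg assms(1) by (simp add: add_nonneg_nonneg)
  fix s a assume p: "probe q \<delta> x s a"
  show "exp (- s) * a \<le> exit_value q \<delta> y + \<eta>"
  proof (cases "\<eta> < exp (- s) * a")
    case True
    have s: "exp (- s) \<le> 1" "0 < a" using p by (auto simp: probe_def)
    then have "exp (- s) * a \<le> 1 * a" by (intro mult_right_mono) auto
    then have "\<eta> < a" using True by linarith
    then have "exp (- s) * (a - \<eta>) \<le> exit_value q \<delta> y"
      using exit_value_ge assms(2) p True by blast
    moreover have "exp (- s) * \<eta> \<le> 1 * \<eta>" using s assms(1) by (intro mult_right_mono) auto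
    ultimately show ?thesis by (simp add: algebra_simps)
  next
    case False
    then show ?thesis using exit_value_nonneg[of q \<delta> y] by linarith
  qed
qed

text \<open>Uniformity in \<open>q\<close> and \<open>\<delta>\<close>: late probes are damped by \<open>exp (- s)\<close>, and if the orbit of \<open>x\<close> is not
  defined long enough, it has crossed the level \<open>hi\<close> before, which forbids substantial later probes
  for all nearby points as well.\<close>
lemma exit_value_equicontinuous:
  assumes "0 < \<eta>"
  shows "\<exists>e>0. \<forall>y. dist x y < e \<longrightarrow>
     (\<forall>q \<delta>. \<delta> \<le> hi - lo \<longrightarrow> \<bar>exit_value q \<delta> x - exit_value q \<delta> y\<bar> \<le> \<eta>)"
proof -
  \<comment> \<open>From time \<open>S\<close> on, a probe is worth at most \<open>\<eta>\<close>,
    since its margin is at most \<open>hi - lo\<close>.\<close>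
  define S where "S = ln ((hi - lo) / \<eta>)"
  have expS: "exp (- S) * (hi - lo) = \<eta>"
    using assms lo_less_hi by (simp add: S_def exp_minus)
  obtain \<sigma> where \<sigma>: "0 \<le> \<sigma>" "\<sigma> \<in> flow_dom \<Gamma> x" "S \<le> \<sigma> \<or> hi < w (\<phi> \<sigma> x)"
    using leaves_compact_or_lasts[OF compact_sublevel, of x S] by auto
  obtain e where e: "e > 0" and near: "\<And>y r. dist x y < e \<Longrightarrow> 0 \<le> r \<Longrightarrow> r \<le> \<sigma> \<Longrightarrow>
      r \<in> flow_dom \<Gamma> y \<and> dist (\<phi> r x) (\<phi> r y) < \<eta>"
    using flow_tube[OF \<sigma>(2,1) assms] by (metis atLeastAtMost_iff)
  show ?thesis
  proof (intro exI[of _ e] conjI e allI impI)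
    fix y q \<delta> assume y: "dist x y < e" and \<delta>: "\<delta> \<le> hi - lo"
    \<comment> \<open>Needed for both points, as probes are transferred both ways. If
      \<open>x\<close> is above \<open>hi\<close> at time \<open>\<sigma>\<close>, then
      \<open>z\<close> is above \<open>hi - \<eta>\<close>, whereas a probe with margin
      \<open>a > \<eta>\<close> running past \<open>\<sigma>\<close> would force \<open>z\<close> to
      be at most \<open>hi - a\<close> there. Otherwise \<open>S \<le> \<sigma>\<close>, and a later
      probe is worth too little.\<close>
    have s_le: "s \<le> \<sigma>"
      if p: "probe q \<delta> z s a" and a: "\<eta> < exp (- s) * a" "\<eta> < a" and z: "z = x \<or> z = y" for z s a
    proof (rule ccontr)
      assume "\<not> s \<le> \<sigma>"
      then have "w (\<phi> \<sigma> z) + a \<le> hi" using p \<sigma> \<delta> by (force simp: probe_def)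
      moreover have "\<bar>w (\<phi> \<sigma> x) - w (\<phi> \<sigma> z)\<bar> \<le> \<eta>"
        using z near[OF y, of \<sigma>] \<sigma> w_lipschitz[of "\<phi> \<sigma> x" "\<phi> \<sigma> y"] assms by auto
      ultimately have "S \<le> s" using \<sigma> a \<open>\<not> s \<le> \<sigma>\<close> by linarith
      have "0 < a" "a \<le> hi - lo"
        using p \<delta> zero_le_dist[of q "\<phi> s z"] unfolding probe_def by linarith+
      then have "exp (- s) * a \<le> exp (- S) * (hi - lo)"
        using \<open>S \<le> s\<close> by (intro mult_mono) auto
      then show False using expS a by simp
    qed
    have "exit_value q \<delta> x \<le> exit_value q \<delta> y + \<eta>"
    proof (rule exit_value_mono_perturb)
      fix s a assume p: "probe q \<delta> x s a" and a: "\<eta> < exp (- s) * a" "\<eta> < a"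
      have "s \<le> \<sigma>" using s_le[OF p a] by simp
      then show "probe q \<delta> y s (a - \<eta>)"
        using near[OF y] by (intro probe_perturb[OF p a(2)]) (auto simp: less_imp_le)
    qed (use assms in simp)
    moreover have "exit_value q \<delta> y \<le> exit_value q \<delta> x + \<eta>"
    proof (rule exit_value_mono_perturb)
      fix s a assume p: "probe q \<delta> y s a" and a: "\<eta> < exp (- s) * a" "\<eta> < a"
      have "s \<le> \<sigma>" using s_le[OF p a] by simp
      then show "probe q \<delta> x s (a - \<eta>)"
        using near[OF y] dom_interval[OF zero_dom \<sigma>(2)]
        by (intro probe_perturb[OF p a(2)]) (auto simp: less_imp_le dist_commute)
    qed (use assms in simp)
    ultimately show "\<bar>exit_value q \<delta> x - exit_value q \<delta> y\<bar> \<le> \<eta>" by linarith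
  qed
qed

text \<open>A probe needs \<open>w > lo\<close> at its final time, so none of \<open>x\<close> ends
  by time \<open>t\<close>. Shifting time by \<open>t\<close> thus matches the probes of
  \<open>x\<close> with those of \<open>\<phi> t x\<close>, keeping the margin and changing the
  weight by \<open>exp t\<close>.\<close>

lemma exit_value_flow:
  assumes t: "0 \<le> t" "t \<in> flow_dom \<Gamma> x" and low: "\<And>r. 0 \<le> r \<Longrightarrow> r \<le> t \<Longrightarrow> w (\<phi> r x) \<le> lo"
  shows "exit_value q \<delta> (\<phi> t x) = exp t * exit_value q \<delta> x"
proof (rule antisym)
  have "exit_value q \<delta> x \<le> exp (- t) * exit_value q \<delta> (\<phi> t x)"
  proof (rule exit_value_le)
    fix s a assume p: "probe q \<delta> x s a"
    have "t < s"
    proof (rule ccontr)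
      assume "\<not> t < s"
      then show False using low[of s] p by (auto simp: probe_def)
    qed
    have sh: "r \<in> flow_dom \<Gamma> (\<phi> t x)" "\<phi> r (\<phi> t x) = \<phi> (r + t) x" if "0 \<le> r" "r \<le> s - t" for r
    proof -
      have "r + t \<in> flow_dom \<Gamma> x"
        using dom_interval[OF zero_dom, of s] p that t by (auto simp: probe_def)
      then show "r \<in> flow_dom \<Gamma> (\<phi> t x)" "\<phi> r (\<phi> t x) = \<phi> (r + t) x"
        using dom_flow[OF t(2)] flow_flow[OF t(2)] by auto
    qed
    have "probe q \<delta> (\<phi> t x) (s - t) a"
      unfolding probe_def
    proof (intro conjI ballI)
      show "0 \<le> s - t" "0 < a" "s - t \<in> flow_dom \<Gamma> (\<phi> t x)"
        using p \<open>t < s\<close> sh(1)[of "s - t"] by (auto simp: probe_def)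
      show "dist q (\<phi> (s - t) (\<phi> t x)) + a \<le> \<delta>" "lo + a \<le> w (\<phi> (s - t) (\<phi> t x))"
        using p \<open>t < s\<close> sh(2)[of "s - t"] by (auto simp: probe_def)
      show "w (\<phi> r (\<phi> t x)) + a \<le> lo + \<delta>" if "r \<in> {0..s - t}" for r
        using p that t(1) sh(2)[of r] by (auto simp: probe_def)
    qed
    then have "exp (- (s - t)) * a \<le> exit_value q \<delta> (\<phi> t x)" by (rule exit_value_ge)
    then have "exp (- t) * (exp (- (s - t)) * a) \<le> exp (- t) * exit_value q \<delta> (\<phi> t x)" by simp
    then show "exp (- s) * a \<le> exp (- t) * exit_value q \<delta> (\<phi> t x)"
      by (simp add: mult.assoc[symmetric] exp_add[symmetric])
  qed (simp add: exit_value_nonneg)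
  then have "exp t * exit_value q \<delta> x \<le> exp t * (exp (- t) * exit_value q \<delta> (\<phi> t x))" by simp
  then show "exp t * exit_value q \<delta> x \<le> exit_value q \<delta> (\<phi> t x)"
    by (simp add: mult.assoc[symmetric] exp_add[symmetric])
  show "exit_value q \<delta> (\<phi> t x) \<le> exp t * exit_value q \<delta> x"
  proof (rule exit_value_le)
    fix s a assume p: "probe q \<delta> (\<phi> t x) s a"
    have s: "0 \<le> s" "s \<in> flow_dom \<Gamma> (\<phi> t x)" using p by (auto simp: probe_def)
    have sh: "r + t \<in> flow_dom \<Gamma> x" "\<phi> r (\<phi> t x) = \<phi> (r + t) x" if "0 \<le> r" "r \<le> s" for r
      using dom_interval[OF zero_dom s(2) that] dom_flow[OF t(2)] flow_flow[OF t(2)] by auto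
    \<comment> \<open>This makes the added initial segment, where \<open>w \<le> lo\<close>, respect
      the ceiling \<open>lo + \<delta>\<close> with margin \<open>a\<close>.\<close>
    have a: "a \<le> \<delta>"
      using p zero_le_dist[of q "\<phi> s (\<phi> t x)"] unfolding probe_def by linarith
    have "w (\<phi> r x) + a \<le> lo + \<delta>" if "0 \<le> r" "r \<le> s + t" for r
    proof (cases "r \<le> t")
      case True
      then show ?thesis using low[of r] that a by simp
    next
      case False
      then have "w (\<phi> (r - t) (\<phi> t x)) + a \<le> lo + \<delta>" using p that by (auto simp: probe_def)
      then show ?thesis using sh[of "r - t"] False that by simp
    qed
    then have "probe q \<delta> x (s + t) a" using p sh[of s] s t(1) by (auto simp: probe_def)
    then have "exp (- (s + t)) * a \<le> exit_value q \<delta> x" by (rule exit_value_ge)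
    then have "exp t * (exp (- (s + t)) * a) \<le> exp t * exit_value q \<delta> x" by simp
    then show "exp (- s) * a \<le> exp t * exit_value q \<delta> x"
      by (simp add: mult.assoc[symmetric] exp_add[symmetric])
  qed (simp add: exit_value_nonneg)
qed

lemma exit_value_flow_local:
  assumes "w x < lo"
  shows "\<exists>\<tau>>0. \<forall>t. \<bar>t\<bar> < \<tau> \<longrightarrow> (\<forall>q \<delta>. exit_value q \<delta> (\<phi> t x) = exp t * exit_value q \<delta> x)"
proof -
  have "open {x. w x < lo}"
    using w_cont by (intro open_Collect_less continuous_on_const)
  then obtain \<tau> where \<tau>: "0 < \<tau>" "\<And>t. \<bar>t\<bar> < \<tau> \<Longrightarrow> t \<in> flow_dom \<Gamma> x \<and> w (\<phi> t x) < lo"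
    using orbit_in_open[of "{x. w x < lo}" x] assms by auto
  show ?thesis
  proof (intro exI[of _ \<tau>] conjI \<tau>(1) allI impI)
    fix t q \<delta> assume t: "\<bar>t\<bar> < \<tau>"
    show "exit_value q \<delta> (\<phi> t x) = exp t * exit_value q \<delta> x"
    proof (cases "0 \<le> t")
      case True
      then show ?thesis using \<tau> t by (intro exit_value_flow) (auto simp: less_imp_le)
    next
      case False
      have d: "t \<in> flow_dom \<Gamma> x" using \<tau>(2)[OF t] by simp
      \<comment> \<open>For negative \<open>t\<close>, start at \<open>\<phi> t x\<close> and flow
        forward to \<open>x\<close>.\<close>
      have "exit_value q \<delta> (\<phi> (- t) (\<phi> t x)) = exp (- t) * exit_value q \<delta> (\<phi> t x)"
      proof (rule exit_value_flow)
        show "- t \<in> flow_dom \<Gamma> (\<phi> t x)" using dom_flow[OF d] by simp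
        fix r assume r: "0 \<le> r" "r \<le> - t"
        then have "\<bar>r + t\<bar> < \<tau>" using t by simp
        then have "r + t \<in> flow_dom \<Gamma> x" "w (\<phi> (r + t) x) < lo" using \<tau>(2) by auto
        then show "w (\<phi> r (\<phi> t x)) \<le> lo" using flow_flow[OF d] by simp
      qed (use False in simp)
      then show ?thesis
        by (simp add: flow_back[OF d] mult.assoc[symmetric] exp_add[symmetric])
    qed
  qed
qed

section \<open>The pseudo-metric of exit values: axioms, expansion and continuity\<close>

lemma exit_value_le_delta: "0 < \<delta> \<Longrightarrow> exit_value q \<delta> x \<le> \<delta>"
  by (rule exit_value_le) (auto dest: probe_le)

lemma bdd_exit_dist:
  "bdd_above ((\<lambda>(q, \<delta>). \<bar>exit_value q \<delta> x - exit_value q \<delta> y\<bar>) ` (UNIV \<times> {0<..hi - lo}))"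
proof (rule bdd_aboveI2[of _ _ "hi - lo"], clarsimp)
  fix q :: 'a and \<delta> assume "0 < \<delta>" "\<delta> \<le> hi - lo"
  then show "\<bar>exit_value q \<delta> x - exit_value q \<delta> y\<bar> \<le> hi - lo"
    using exit_value_le_delta[of \<delta> q x] exit_value_le_delta[of \<delta> q y]
      exit_value_nonneg[of q \<delta> x] exit_value_nonneg[of q \<delta> y] by linarith
qed

lemma exit_dist_ge:
  assumes "0 < \<delta>" "\<delta> \<le> hi - lo"
  shows "\<bar>exit_value q \<delta> x - exit_value q \<delta> y\<bar> \<le> exit_dist x y"
  unfolding exit_dist_def using cSUP_upper[OF _ bdd_exit_dist, of "(q, \<delta>)" x y] assms by auto

lemma exit_dist_le:
  assumes "\<And>q \<delta>. 0 < \<delta> \<Longrightarrow> \<delta> \<le> hi - lo \<Longrightarrow> \<bar>exit_value q \<delta> x - exit_value q \<delta> y\<bar> \<le> B"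
  shows "exit_dist x y \<le> B"
  unfolding exit_dist_def using assms lo_less_hi by (intro cSUP_least) auto

lemma exit_dist_nonneg: "0 \<le> exit_dist x y"
  using exit_dist_ge[of "hi - lo" undefined x y] lo_less_hi by simp

lemma exit_dist_self: "exit_dist x x = 0"
  using exit_dist_le[of x x 0] exit_dist_nonneg[of x x] by simp

lemma exit_dist_sym: "exit_dist x y = exit_dist y x"
  unfolding exit_dist_def by (simp add: abs_minus_commute)

lemma exit_dist_triangle: "exit_dist x z \<le> exit_dist x y + exit_dist y z"
proof (rule exit_dist_le)
  fix q \<delta> assume "0 < \<delta>" "\<delta> \<le> hi - lo"
  then show "\<bar>exit_value q \<delta> x - exit_value q \<delta> z\<bar> \<le> exit_dist x y + exit_dist y z"
    using exit_dist_ge[of \<delta> q x y] exit_dist_ge[of \<delta> q y z] by linarith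
qed

text \<open>Used once with factor \<open>exp t\<close> and once, with the two pairs exchanged, with
  \<open>exp (- t)\<close>; together these give the exact scaling law.\<close>

lemma exit_dist_scale:
  assumes "0 < c" "\<And>q \<delta>. exit_value q \<delta> x' = c * exit_value q \<delta> x"
    "\<And>q \<delta>. exit_value q \<delta> y' = c * exit_value q \<delta> y"
  shows "exit_dist x' y' \<le> c * exit_dist x y"
proof (rule exit_dist_le)
  fix q \<delta> assume d: "0 < \<delta>" "\<delta> \<le> hi - lo"
  have "\<bar>exit_value q \<delta> x' - exit_value q \<delta> y'\<bar> = c * \<bar>exit_value q \<delta> x - exit_value q \<delta> y\<bar>"
    using assms by (simp add: right_diff_distrib[symmetric] abs_mult)
  then show "\<bar>exit_value q \<delta> x' - exit_value q \<delta> y'\<bar> \<le> c * exit_dist x y"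
    using exit_dist_ge[OF d] assms(1) by simp
qed

lemma exit_dist_flow_local:
  assumes "w x < lo" "w y < lo"
  shows "\<exists>\<tau>>0. \<forall>t. \<bar>t\<bar> < \<tau> \<longrightarrow> exit_dist (\<phi> t x) (\<phi> t y) = exp t * exit_dist x y"
proof -
  obtain \<tau>1 where 1: "0 < \<tau>1" "\<And>t q \<delta>. \<bar>t\<bar> < \<tau>1 \<Longrightarrow>
      exit_value q \<delta> (\<phi> t x) = exp t * exit_value q \<delta> x"
    using exit_value_flow_local[OF assms(1)] by blast
  obtain \<tau>2 where 2: "0 < \<tau>2" "\<And>t q \<delta>. \<bar>t\<bar> < \<tau>2 \<Longrightarrow>
      exit_value q \<delta> (\<phi> t y) = exp t * exit_value q \<delta> y"
    using exit_value_flow_local[OF assms(2)] by blast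
  show ?thesis
  proof (intro exI[of _ "min \<tau>1 \<tau>2"] conjI allI impI)
    fix t assume "\<bar>t\<bar> < min \<tau>1 \<tau>2"
    then have t: "exit_value q \<delta> (\<phi> t x) = exp t * exit_value q \<delta> x"
      "exit_value q \<delta> (\<phi> t y) = exp t * exit_value q \<delta> y" for q \<delta>
      using 1 2 by auto
    have t': "exit_value q \<delta> x = exp (- t) * exit_value q \<delta> (\<phi> t x)"
      "exit_value q \<delta> y = exp (- t) * exit_value q \<delta> (\<phi> t y)" for q \<delta>
      by (simp_all add: t mult.assoc[symmetric] exp_add[symmetric])
    have "exit_dist x y \<le> exp (- t) * exit_dist (\<phi> t x) (\<phi> t y)"
      by (rule exit_dist_scale[OF _ t']) simp
    then have "exp t * exit_dist x y \<le> exp t * (exp (- t) * exit_dist (\<phi> t x) (\<phi> t y))" by simp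
    also have "\<dots> = exit_dist (\<phi> t x) (\<phi> t y)"
      by (simp add: mult.assoc[symmetric] exp_add[symmetric])
    finally show "exit_dist (\<phi> t x) (\<phi> t y) = exp t * exit_dist x y"
      using exit_dist_scale[OF _ t] by (simp add: antisym)
  qed (use 1 2 in simp)
qed

text \<open>By the triangle inequality it suffices that \<open>exit_dist z z'\<close> is small for
  \<open>z'\<close> near \<open>z\<close>. This is the equicontinuity of the exit values, uniform in
  \<open>q\<close> and \<open>\<delta>\<close>.\<close>

lemma exit_dist_cont: "continuous_on A (\<lambda>(x, y). exit_dist x y)"
proof (rule continuous_on_subset[OF _ subset_UNIV], unfold continuous_on_iff, clarsimp)
  fix x y and \<eta> :: real assume \<eta>: "0 < \<eta>"
  have small: "\<exists>e>0. \<forall>z'. dist z z' < e \<longrightarrow> exit_dist z z' \<le> \<eta> / 3" for z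
  proof -
    obtain e where "0 < e" "\<And>z' q \<delta>. dist z z' < e \<Longrightarrow> \<delta> \<le> hi - lo \<Longrightarrow>
        \<bar>exit_value q \<delta> z - exit_value q \<delta> z'\<bar> \<le> \<eta> / 3"
      using exit_value_equicontinuous[of "\<eta> / 3" z] \<eta> by auto
    then show ?thesis by (intro exI[of _ e] conjI allI impI exit_dist_le) auto
  qed
  obtain e1 where e1: "0 < e1" "\<And>x'. dist x x' < e1 \<Longrightarrow> exit_dist x x' \<le> \<eta> / 3"
    using small by blast
  obtain e2 where e2: "0 < e2" "\<And>y'. dist y y' < e2 \<Longrightarrow> exit_dist y y' \<le> \<eta> / 3"
    using small by blast
  show "\<exists>e>0. \<forall>x' y'. dist (x', y') (x, y) < e \<longrightarrow> dist (exit_dist x' y') (exit_dist x y) < \<eta>"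
  proof (intro exI[of _ "min e1 e2"] conjI allI impI)
    fix x' y' assume d: "dist (x', y') (x, y) < min e1 e2"
    have "dist x' x \<le> dist (x', y') (x, y)" "dist y' y \<le> dist (x', y') (x, y)"
      using dist_fst_le[of "(x', y')" "(x, y)"] dist_snd_le[of "(x', y')" "(x, y)"] by auto
    then have "exit_dist x x' \<le> \<eta> / 3" "exit_dist y y' \<le> \<eta> / 3"
      using d e1(2)[of x'] e2(2)[of y'] by (simp_all add: dist_commute)
    then show "dist (exit_dist x' y') (exit_dist x y) < \<eta>"
      using exit_dist_triangle[of x' y' x] exit_dist_triangle[of x y' y]
        exit_dist_triangle[of x y x'] exit_dist_triangle[of x' y y'] \<eta>
        exit_dist_sym[of x x'] exit_dist_sym[of y y']
      by (simp add: dist_real_def)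
  qed (use e1 e2 in simp)
qed

section \<open>Recovering a point from its exit values\<close>

text \<open>The value \<open>w\<close> may cross \<open>lo\<close> back and forth right after the first exit, so only
  accumulation of outside times at \<open>T\<close> from the right is required.\<close>
definition exit_time :: "'a \<Rightarrow> real \<Rightarrow> bool" where
  "exit_time x T \<longleftrightarrow> 0 \<le> T \<and> T \<in> flow_dom \<Gamma> x \<and> (\<forall>r\<in>{0..T}. w (\<phi> r x) \<le> lo) \<and>
     (\<forall>\<tau>>T. \<exists>s. T < s \<and> s < \<tau> \<and> s \<in> flow_dom \<Gamma> x \<and> lo < w (\<phi> s x))"

lemma exit_time_exists:
  assumes "w x \<le> lo" "0 \<le> t" "t \<in> flow_dom \<Gamma> x" "lo < w (\<phi> t x)"
  shows "\<exists>T. exit_time x T"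
proof -
  define E where "E = {s \<in> {0..t}. lo < w (\<phi> s x)}"
  \<comment> \<open>The infimum of the times outside \<open>{w \<le> lo}\<close>; continuity will
    show that it is not itself such a time.\<close>
  define T where "T = Inf E"
  have "t \<in> E" using assms by (simp add: E_def)
  have bdd: "bdd_below E" by (rule bdd_belowI[of _ 0]) (simp add: E_def)
  have Tt: "T \<le> t" unfolding T_def using bdd \<open>t \<in> E\<close> by (rule cInf_lower[rotated])
  have T0: "0 \<le> T" unfolding T_def using \<open>t \<in> E\<close> by (intro cInf_greatest) (auto simp: E_def)
  have dom: "r \<in> flow_dom \<Gamma> x" if "r \<in> {0..t}" for r
    using dom_interval[OF zero_dom assms(3)] that by simp
  have below: "w (\<phi> r x) \<le> lo" if "0 \<le> r" "r < T" for r
  proof (rule ccontr)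
    assume "\<not> w (\<phi> r x) \<le> lo"
    then have "r \<in> E" using that Tt by (simp add: E_def)
    then show False using cInf_lower[OF _ bdd] that by (force simp: T_def)
  qed
  have wT: "w (\<phi> T x) \<le> lo"
  proof (rule ccontr)
    assume "\<not> w (\<phi> T x) \<le> lo"
    then have pos: "0 < w (\<phi> T x) - lo" by simp
    then have "T \<noteq> 0" using assms(1) by auto
    have "continuous_on {0..t} (\<lambda>r. w (\<phi> r x))"
      by (rule continuous_on_compose2[OF w_cont[of UNIV]])
        (auto intro!: continuous_on_subset[OF orbit_cont] dom)
    then obtain d where d: "d > 0" "\<And>r. r \<in> {0..t} \<Longrightarrow> dist r T < d \<Longrightarrow>
        dist (w (\<phi> r x)) (w (\<phi> T x)) < w (\<phi> T x) - lo"
      unfolding continuous_on_iff using pos T0 Tt by (metis atLeastAtMost_iff)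
    \<comment> \<open>A time before \<open>T\<close>, hence with \<open>w \<le> lo\<close>, yet so
      close to \<open>T\<close> that continuity forces \<open>w > lo\<close>.\<close>
    let ?r = "max 0 (T - d / 2)"
    have "w (\<phi> ?r x) \<le> lo" using d(1) T0 \<open>T \<noteq> 0\<close> by (intro below) auto
    moreover have "dist (w (\<phi> ?r x)) (w (\<phi> T x)) < w (\<phi> T x) - lo"
      using d(1) T0 Tt by (intro d(2)) (auto simp: dist_real_def max_def)
    ultimately show False by (simp add: dist_real_def)
  qed
  have "\<exists>s. T < s \<and> s < \<tau> \<and> s \<in> flow_dom \<Gamma> x \<and> lo < w (\<phi> s x)" if \<tau>: "T < \<tau>" for \<tau>
  proof -
    obtain s where s: "s \<in> E" "s < \<tau>"
      using \<tau> \<open>t \<in> E\<close> cInf_lessD[of E \<tau>] unfolding T_def by auto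
    then have "T \<le> s" using cInf_lower[OF _ bdd] by (simp add: T_def)
    moreover have "s \<noteq> T" using wT s by (auto simp: E_def)
    ultimately show ?thesis using s dom by (intro exI[of _ s]) (auto simp: E_def)
  qed
  moreover have "w (\<phi> r x) \<le> lo" if "r \<in> {0..T}" for r
    using below[of r] wT that by (cases "r = T") auto
  ultimately show ?thesis using T0 Tt dom by (intro exI[of _ T]) (auto simp: exit_time_def)
qed

lemma probe_at_exit:
  assumes T: "exit_time x T" and "0 < \<delta>"
  shows "\<exists>s a. probe (\<phi> T x) \<delta> x s a"
proof -
  let ?p = "\<phi> T x"
  have T': "0 \<le> T" "T \<in> flow_dom \<Gamma> x" "\<And>r. 0 \<le> r \<Longrightarrow> r \<le> T \<Longrightarrow> w (\<phi> r x) \<le> lo"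
    using T by (auto simp: exit_time_def)
  obtain \<tau> where \<tau>: "0 < \<tau>" "\<And>t. \<bar>t\<bar> < \<tau> \<Longrightarrow> t \<in> flow_dom \<Gamma> ?p \<and> \<phi> t ?p \<in> ball ?p (\<delta> / 2)"
    using orbit_in_open[of "ball ?p (\<delta> / 2)" ?p] assms by auto
  obtain s where s: "T < s" "s < T + \<tau>" "s \<in> flow_dom \<Gamma> x" "lo < w (\<phi> s x)"
    using T \<tau>(1) unfolding exit_time_def by (metis less_add_same_cancel1)
  have near: "dist ?p (\<phi> r x) < \<delta> / 2" if "T \<le> r" "r \<le> s" for r
  proof -
    have "r \<in> flow_dom \<Gamma> x" using dom_interval[OF T'(2) s(3)] that by simp
    then have "\<phi> (r - T) ?p = \<phi> r x" using flow_flow[OF T'(2), of "r - T"] by simp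
    then show ?thesis using \<tau>(2)[of "r - T"] that s by simp
  qed
  \<comment> \<open>Half of \<open>\<delta>\<close> is reserved for the distance from the exit
    point, which by the Lipschitz bound also controls the rise of \<open>w\<close> above
    \<open>lo\<close>. The second term is the excess over \<open>lo\<close> available at time
    \<open>s\<close>.\<close>
  define a where "a = min (\<delta> / 2) (w (\<phi> s x) - lo)"
  have "w (\<phi> r x) + a \<le> lo + \<delta>" if r: "r \<in> {0..s}" for r
  proof (cases "r \<le> T")
    case True
    then show ?thesis using T'(3)[of r] r assms(2) by (auto simp: a_def min_def)
  next
    case False
    then show ?thesis
      using near[of r] r w_lipschitz[of ?p "\<phi> r x"] T'(1) T'(3)[of T]
      by (auto simp: a_def min_def)
  qed
  then have "probe ?p \<delta> x s a"
    using s near[of s] T'(1) assms(2) by (auto simp: probe_def a_def min_def)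
  then show ?thesis by blast
qed

lemma exit_value_at_exit:
  assumes "exit_time x T"
  shows "exit_value q \<delta> (\<phi> T x) = exp T * exit_value q \<delta> x"
  using assms by (intro exit_value_flow) (auto simp: exit_time_def)

text \<open>All exit values of \<open>x\<close> and \<open>y\<close> agree. Those centred at the
  exit point of \<open>x\<close> are positive at every scale, which forces \<open>y\<close> to exit
  at the same point. The exponential scaling then makes the exit times equal, and flowing back from
  the common point gives \<open>x = y\<close>.\<close>

lemma eq_if_exit_dist_eq_0:
  assumes x: "w x \<le> lo" "0 \<le> t" "t \<in> flow_dom \<Gamma> x" "lo < w (\<phi> t x)"
    and y: "w y \<le> lo" and zero: "exit_dist x y = 0"
  shows "x = y"
proof -
  have eq: "exit_value q \<delta> x = exit_value q \<delta> y" if "0 < \<delta>" "\<delta> \<le> hi - lo" for q \<delta>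
    using exit_dist_ge[OF that, of q x y] zero by simp
  obtain T where T: "exit_time x T" using exit_time_exists[OF x] by blast
  define p where "p = \<phi> T x"
  have pos: "0 < exit_value p \<delta> x" if "0 < \<delta>" for \<delta>
    using probe_at_exit[OF T that] exit_value_pos unfolding p_def by blast
  \<comment> \<open>Positivity passes from \<open>x\<close> to \<open>y\<close>, so the orbit of
    \<open>y\<close> also comes above \<open>lo\<close> arbitrarily close to
    \<open>p\<close>.\<close>
  have probe_y: "\<exists>s a. probe p \<delta> y s a" if "0 < \<delta>" "\<delta> \<le> hi - lo" for \<delta>
    using pos[OF that(1)] eq[OF that] by (metis probe_of_exit_value_pos)
  obtain s0 a0 where "probe p (hi - lo) y s0 a0" using probe_y[of "hi - lo"] lo_less_hi by auto
  then have "0 \<le> s0" "s0 \<in> flow_dom \<Gamma> y" "lo < w (\<phi> s0 y)" by (auto simp: probe_def)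
  then obtain T' where T': "exit_time y T'" using exit_time_exists[OF y] by blast
  define p' where "p' = \<phi> T' y"
  have T'_dom: "0 \<le> T'" "T' \<in> flow_dom \<Gamma> y" "\<And>r. 0 \<le> r \<Longrightarrow> r \<le> T' \<Longrightarrow> w (\<phi> r y) \<le> lo"
    using T' by (auto simp: exit_time_def)
  have T_dom: "T \<in> flow_dom \<Gamma> x" using T by (auto simp: exit_time_def)
  have "dist p p' < 2 * \<eta>" if \<eta>: "0 < \<eta>" for \<eta>
  proof -
    obtain \<tau> where \<tau>: "0 < \<tau>" "\<And>t. \<bar>t\<bar> < \<tau> \<Longrightarrow> t \<in> flow_dom \<Gamma> p' \<and> \<phi> t p' \<in> ball p' \<eta>"
      using orbit_in_open[of "ball p' \<eta>" p'] \<eta> by auto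
    obtain s' where s': "T' < s'" "s' < T' + \<tau>" "lo < w (\<phi> s' y)"
      using T' \<tau>(1) unfolding exit_time_def by (metis less_add_same_cancel1)
    \<comment> \<open>The last term places the ceiling \<open>lo + \<delta>\<close> no higher than
      \<open>w\<close> at time \<open>s'\<close>, so a probe of \<open>y\<close> must end before
      \<open>s'\<close>. It also ends after \<open>T'\<close>, hence at a moment when the orbit of
      \<open>y\<close> is within \<open>\<eta>\<close> of \<open>p'\<close>; as
      \<open>\<delta> \<le> \<eta>\<close>, it is within \<open>\<eta>\<close> of \<open>p\<close>
      too.\<close>
    define \<delta> where "\<delta> = min (min \<eta> (hi - lo)) (w (\<phi> s' y) - lo)"
    have \<delta>: "0 < \<delta>" "\<delta> \<le> hi - lo" "\<delta> \<le> \<eta>" "lo + \<delta> \<le> w (\<phi> s' y)"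
      using \<eta> lo_less_hi s' by (auto simp: \<delta>_def)
    obtain s a where pr: "probe p \<delta> y s a" using probe_y[OF \<delta>(1,2)] by blast
    then have s: "0 \<le> s" "0 < a" "s \<in> flow_dom \<Gamma> y" "dist p (\<phi> s y) + a \<le> \<delta>" "lo + a \<le> w (\<phi> s y)"
      "\<And>r. 0 \<le> r \<Longrightarrow> r \<le> s \<Longrightarrow> w (\<phi> r y) + a \<le> lo + \<delta>"
      by (auto simp: probe_def)
    have "T' < s" using T'_dom(3)[of s] s by force
    moreover have "s < s'" using s(6)[of s'] s(2) s'(1) T'_dom(1) \<delta>(4) by force
    moreover have "\<phi> (s - T') p' = \<phi> s y"
      unfolding p'_def using flow_flow[OF T'_dom(2), of "s - T'"] s(3) by simp
    ultimately have "dist p' (\<phi> s y) < \<eta>" using \<tau>(2)[of "s - T'"] s' by simp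
    then show ?thesis using s(2,4) \<delta>(3) dist_triangle2[of p p' "\<phi> s y"] by linarith
  qed
  from this[of "dist p p' / 2"] have "p = p'" by (cases "p = p'") auto
  \<comment> \<open>Both sides are the exit value of the common exit point; cancelling the equal
    positive values of \<open>x\<close> and \<open>y\<close> leaves
    \<open>exp T = exp T'\<close>.\<close>
  have "exp T * exit_value p (hi - lo) x = exp T' * exit_value p (hi - lo) y"
    using exit_value_at_exit[OF T, of p "hi - lo"] exit_value_at_exit[OF T', of p "hi - lo"] \<open>p = p'\<close>
    by (simp add: p_def p'_def)
  then have "T = T'" using eq[of "hi - lo" p] pos[of "hi - lo"] lo_less_hi by simp
  then show ?thesis
    using flow_back[OF T_dom] flow_back[OF T'_dom(2)] \<open>p = p'\<close> unfolding p_def p'_def by metis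
qed

lemma exit_value_eq_0:
  assumes "\<And>t. 0 \<le> t \<Longrightarrow> t \<in> flow_dom \<Gamma> x \<Longrightarrow> w (\<phi> t x) \<le> lo"
  shows "exit_value q \<delta> x = 0"
proof -
  have "\<not> probe q \<delta> x s a" for s a using assms[of s] by (auto simp: probe_def)
  then show ?thesis using exit_value_nonneg[of q \<delta> x] by (metis less_eq_real_def probe_of_exit_value_pos)
qed

lemma exit_dist_eq_0:
  assumes "\<And>t. 0 \<le> t \<Longrightarrow> t \<in> flow_dom \<Gamma> x \<Longrightarrow> w (\<phi> t x) \<le> lo"
    and "\<And>t. 0 \<le> t \<Longrightarrow> t \<in> flow_dom \<Gamma> y \<Longrightarrow> w (\<phi> t y) \<le> lo"
  shows "exit_dist x y = 0"
  using exit_dist_le[of x y 0] exit_dist_nonneg[of x y] by (simp add: exit_value_eq_0 assms)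

end

section \<open>Assembling the catenary pseudo-metric from both time directions\<close>

text \<open>If the orbit of a limit point of \<open>\<Lambda>\<close> left the closed set
  \<open>N\<close> at time \<open>t\<close>, so would the orbits of nearby points of
  \<open>\<Lambda>\<close>, against invariance. Hence that orbit stays in \<open>N\<close>, and
  isolation applies.\<close>

lemma isolated_set_closed:
  assumes "part_flow \<Gamma> \<phi>" "flow_invariant \<Gamma> \<phi> \<Lambda>" "isolating_nbhd \<Gamma> \<phi> \<Lambda> N"
  shows "closed \<Lambda>"
proof -
  interpret part_flow \<Gamma> \<phi> by fact
  have N: "closed N" "\<Lambda> \<subseteq> N"
    using assms(3) interior_subset by (auto simp: isolating_nbhd_def compact_imp_closed)
  have "x \<in> \<Lambda>" if x: "x \<in> closure \<Lambda>" for x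
  proof -
    have "\<phi> t x \<in> N" if t: "t \<in> flow_dom \<Gamma> x" for t
    proof (rule ccontr)
      assume n: "\<phi> t x \<notin> N"
      have "{x. t \<in> flow_dom \<Gamma> x} = (\<lambda>x. (t, x)) -` \<Gamma>" by (auto simp: flow_dom_def)
      moreover have "open ((\<lambda>x. (t, x)) -` \<Gamma>)"
        by (intro continuous_open_vimage open_Gamma continuous_intros)
      ultimately have "open {x. t \<in> flow_dom \<Gamma> x}" by simp
      then have "open (\<phi> t -` (- N) \<inter> {x. t \<in> flow_dom \<Gamma> x})"
        using time_slice_cont continuous_on_open_vimage N(1) by blast
      moreover have "x \<in> \<phi> t -` (- N) \<inter> {x. t \<in> flow_dom \<Gamma> x}" using n t by simp
      ultimately obtain z where "z \<in> \<Lambda>" "z \<in> \<phi> t -` (- N) \<inter> {x. t \<in> flow_dom \<Gamma> x}"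
        using x by (meson closure_iff_nhds_not_empty disjoint_iff order_refl)
      then show False using assms(2) N by (auto simp: flow_invariant_def)
    qed
    then show ?thesis using assms(3) by (auto simp: isolating_nbhd_def)
  qed
  then show ?thesis using closure_subset closure_closed by (metis closure_subset_eq subsetI)
qed

text \<open>The formula holds for all small \<open>t\<close>, whether or not the orbits stay in
  \<open>N\<close>, so there is a full two-sided derivative, which then restricts to the admissible
  times.\<close>

lemma has_flow_deriv_local_exp:
  assumes "\<And>x y. x \<in> N \<Longrightarrow> y \<in> N \<Longrightarrow>
      \<exists>\<tau>>0. \<forall>t. \<bar>t\<bar> < \<tau> \<longrightarrow> F (\<phi> t x) (\<phi> t y) = exp t * A x y + exp (- t) * B x y"
  shows "has_flow_deriv \<Gamma> \<phi> N F (\<lambda>x y. A x y - B x y)"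
  unfolding has_flow_deriv_def
proof (intro ballI)
  fix x y assume "x \<in> N" "y \<in> N"
  then obtain \<tau> where \<tau>: "0 < \<tau>" "\<And>t. \<bar>t\<bar> < \<tau> \<Longrightarrow>
      F (\<phi> t x) (\<phi> t y) = exp t * A x y + exp (- t) * B x y"
    using assms by blast
  have "((\<lambda>t. exp t * A x y + exp (- t) * B x y) has_real_derivative A x y - B x y) (at 0)"
    by (auto intro!: derivative_eq_intros)
  moreover have "\<forall>\<^sub>F t in nhds 0. exp t * A x y + exp (- t) * B x y = F (\<phi> t x) (\<phi> t y)"
    unfolding eventually_nhds_metric using \<tau> by (intro exI[of _ \<tau>]) (auto simp: dist_real_def)
  ultimately have "((\<lambda>t. F (\<phi> t x) (\<phi> t y)) has_real_derivative A x y - B x y) (at 0)"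
    by (subst (asm) DERIV_cong_ev[OF refl _ refl])
  then show "((\<lambda>t. F (\<phi> t x) (\<phi> t y)) has_real_derivative A x y - B x y)
      (at 0 within {t. t \<in> flow_dom \<Gamma> x \<and> t \<in> flow_dom \<Gamma> y \<and> \<phi> t x \<in> N \<and> \<phi> t y \<in> N})"
    by (rule has_field_derivative_at_within)
qed

lemma catenary_pseudo_metric_exists:
  assumes pf: "partial_flow \<Gamma> \<phi>" and iso: "isolated_set \<Gamma> \<phi> \<Lambda>" and ne: "\<Lambda> \<noteq> {}"
  shows "\<exists>N d. catenary_pseudo_metric \<Gamma> \<phi> \<Lambda> N d"
proof -
  interpret part_flow \<Gamma> \<phi> by unfold_locales (rule pf)
  obtain N0 where inv: "flow_invariant \<Gamma> \<phi> \<Lambda>" and N0: "isolating_nbhd \<Gamma> \<phi> \<Lambda> N0"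
    using iso by (auto simp: isolated_set_def)
  then have cN0: "compact N0" and int: "\<Lambda> \<subseteq> interior N0"
    and isol: "\<And>x. (\<And>t. t \<in> flow_dom \<Gamma> x \<Longrightarrow> \<phi> t x \<in> N0) \<Longrightarrow> x \<in> \<Lambda>"
    by (auto simp: isolating_nbhd_def)
  have cl: "closed \<Lambda>" using isolated_set_closed part_flow_axioms inv N0 by blast
  have "compact \<Lambda>"
    using compact_Int_closed[OF cN0 cl] int interior_subset by (metis inf.absorb2 subset_trans)
  then obtain e where e: "0 < e" "(\<Union>p\<in>\<Lambda>. ball p e) \<subseteq> interior N0"
    using compact_subset_open_imp_ball_epsilon_subset[OF _ open_interior int] by metis
  \<comment> \<open>All three levels \<open>\<epsilon>\<close>, \<open>2 * \<epsilon>\<close> and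
    \<open>3 * \<epsilon>\<close> lie below \<open>e\<close>, so their sublevels lie in
    \<open>N0\<close>.\<close>
  define \<epsilon> where "\<epsilon> = e / 4"
  \<comment> \<open>Here \<open>\<Lambda> \<noteq> {}\<close> matters: \<open>infdist\<close> to the
    empty set is 0 by convention.\<close>
  define w where "w x = infdist x \<Lambda>" for x
  have \<epsilon>: "0 < \<epsilon>" using e by (simp add: \<epsilon>_def)
  have sub: "{x. w x \<le> 3 * \<epsilon>} \<subseteq> N0"
  proof
    fix x assume "x \<in> {x. w x \<le> 3 * \<epsilon>}"
    then have "infdist x \<Lambda> < e" using e by (simp add: w_def \<epsilon>_def)
    then obtain p where "p \<in> \<Lambda>" "dist x p < e"
      using ne by (auto simp: infdist_def cINF_less_iff)
    then show "x \<in> N0" using e interior_subset by (force simp: dist_commute)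
  qed
  have wl: "\<bar>w x - w y\<bar> \<le> dist x y" for x y
    using infdist_triangle_abs by (simp add: w_def)
  have w_cont: "continuous_on UNIV w" unfolding w_def by (intro continuous_intros)
  have cpt: "compact {x. w x \<le> c}" if "c \<le> 3 * \<epsilon>" for c
  proof -
    have "closed {x. w x \<le> c}" using w_cont by (intro closed_Collect_le continuous_on_const)
    then have "compact (N0 \<inter> {x. w x \<le> c})" using cN0 by (rule compact_Int_closed[rotated])
    moreover have "{x. w x \<le> c} \<subseteq> N0" using sub that by auto
    ultimately show ?thesis by (simp add: inf.absorb2)
  qed
  \<comment> \<open>\<open>N\<close> lies strictly below the level \<open>lo = 2 * \<epsilon>\<close>: orbits may leave \<open>N\<close> and return within arbitrarily
    short time, but they stay in \<open>{w \<le> lo}\<close> meanwhile.\<close>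
  define N where "N = {x. w x \<le> \<epsilon>}"
  have w0: "w x = 0" if "x \<in> \<Lambda>" for x using that by (simp add: w_def)
  have isoN: "isolating_nbhd \<Gamma> \<phi> \<Lambda> N"
    unfolding isolating_nbhd_def
  proof (intro conjI allI impI)
    show "compact N" using cpt[of \<epsilon>] \<epsilon> by (simp add: N_def)
    have "open {x. w x < \<epsilon>}" using w_cont by (intro open_Collect_less continuous_on_const)
    then have "{x. w x < \<epsilon>} \<subseteq> interior N" by (intro interior_maximal) (auto simp: N_def)
    then show "\<Lambda> \<subseteq> interior N" using w0 \<epsilon> by auto
    have "N \<subseteq> N0" using sub \<epsilon> by (auto simp: N_def)
    then show "x \<in> \<Lambda>" if "(\<lambda>t. \<phi> t x) ` flow_dom \<Gamma> x \<subseteq> N" for x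
      using that by (intro isol) auto
  qed
  let ?G = "{(t, x). (- t, x) \<in> \<Gamma>}" and ?f = "\<lambda>t. \<phi> (- t)"
  have Gdom: "t \<in> flow_dom ?G x \<longleftrightarrow> - t \<in> flow_dom \<Gamma> x" for t x by (simp add: flow_dom_def)
  interpret fw: flow_exit \<Gamma> \<phi> w "2 * \<epsilon>" "3 * \<epsilon>"
    by unfold_locales (use wl \<epsilon> cpt in auto)
  interpret rev: part_flow ?G ?f by (rule reversed)
  interpret bw: flow_exit ?G ?f w "2 * \<epsilon>" "3 * \<epsilon>"
    by unfold_locales (use wl \<epsilon> cpt in auto)
  define d where "d x y = fw.exit_dist x y + bw.exit_dist x y" for x y
  \<comment> \<open>Along the flow the forward part grows like \<open>exp t\<close> and the backward
    part decays like \<open>exp (- t)\<close>, so differentiation flips the sign of the latter and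
    exchanges \<open>d\<close> and \<open>d'\<close>.\<close>
  define d' where "d' x y = fw.exit_dist x y - bw.exit_dist x y" for x y
  have local: "\<exists>\<tau>>0. \<forall>t. \<bar>t\<bar> < \<tau> \<longrightarrow>
      fw.exit_dist (\<phi> t x) (\<phi> t y) = exp t * fw.exit_dist x y \<and>
      bw.exit_dist (\<phi> t x) (\<phi> t y) = exp (- t) * bw.exit_dist x y"
    if "x \<in> N" "y \<in> N" for x y
  proof -
    have xy: "w x < 2 * \<epsilon>" "w y < 2 * \<epsilon>" using that \<epsilon> by (auto simp: N_def)
    obtain \<tau>1 where 1: "0 < \<tau>1" "\<And>t. \<bar>t\<bar> < \<tau>1 \<Longrightarrow>
        fw.exit_dist (\<phi> t x) (\<phi> t y) = exp t * fw.exit_dist x y"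
      using fw.exit_dist_flow_local[OF xy] by blast
    obtain \<tau>2 where 2: "0 < \<tau>2" "\<And>t. \<bar>t\<bar> < \<tau>2 \<Longrightarrow>
        bw.exit_dist (\<phi> (- t) x) (\<phi> (- t) y) = exp t * bw.exit_dist x y"
      using bw.exit_dist_flow_local[OF xy] by blast
    show ?thesis
      using 1 2(1) 2(2)[of "- t" for t] by (intro exI[of _ "min \<tau>1 \<tau>2"]) auto
  qed
  have deriv: "has_flow_deriv \<Gamma> \<phi> N d d'"
  proof -
    have "has_flow_deriv \<Gamma> \<phi> N d (\<lambda>x y. fw.exit_dist x y - bw.exit_dist x y)"
    proof (rule has_flow_deriv_local_exp)
      fix x y assume "x \<in> N" "y \<in> N"
      then show "\<exists>\<tau>>0. \<forall>t. \<bar>t\<bar> < \<tau> \<longrightarrow> d (\<phi> t x) (\<phi> t y) =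
          exp t * fw.exit_dist x y + exp (- t) * bw.exit_dist x y"
        using local[of x y] unfolding d_def by metis
    qed
    then show ?thesis by (simp add: d'_def[abs_def])
  qed
  have deriv': "has_flow_deriv \<Gamma> \<phi> N d' d"
  proof -
    have "has_flow_deriv \<Gamma> \<phi> N d' (\<lambda>x y. fw.exit_dist x y - (- bw.exit_dist x y))"
    proof (rule has_flow_deriv_local_exp)
      fix x y assume "x \<in> N" "y \<in> N"
      then show "\<exists>\<tau>>0. \<forall>t. \<bar>t\<bar> < \<tau> \<longrightarrow> d' (\<phi> t x) (\<phi> t y) =
          exp t * fw.exit_dist x y + exp (- t) * (- bw.exit_dist x y)"
        using local[of x y] by (force simp: d'_def)
    qed
    then show ?thesis by (simp add: d_def[abs_def])
  qed
  have eq: "x = y" if x: "x \<in> N" "x \<notin> \<Lambda>" and y: "y \<in> N" and zero: "d x y = 0" for x y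
  proof -
    have z: "fw.exit_dist x y = 0" "bw.exit_dist x y = 0"
      using zero fw.exit_dist_nonneg[of x y] bw.exit_dist_nonneg[of x y] by (auto simp: d_def)
    have lo: "w x \<le> 2 * \<epsilon>" "w y \<le> 2 * \<epsilon>" using x y \<epsilon> by (auto simp: N_def)
    \<comment> \<open>A point outside \<open>\<Lambda>\<close> leaves \<open>N0\<close>, hence
      exceeds the level \<open>2 * \<epsilon>\<close>, at some time; the sign of this time decides
      which of the two exit distances identifies the point.\<close>
    obtain t where t: "t \<in> flow_dom \<Gamma> x" "\<phi> t x \<notin> N0" using isol x by blast
    then have out: "2 * \<epsilon> < w (\<phi> t x)" using sub \<epsilon> by force
    show ?thesis
    proof (cases "0 \<le> t")
      case True
      then show ?thesis using fw.eq_if_exit_dist_eq_0[OF lo(1) True t(1) out lo(2) z(1)] by simp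
    next
      case False
      then show ?thesis using bw.eq_if_exit_dist_eq_0[of x "- t" y] lo t out z by (simp add: Gdom)
    qed
  qed
  have sym: "d x y = d y x" for x y
    using fw.exit_dist_sym bw.exit_dist_sym by (simp add: d_def)
  have zero: "d x y = 0" if "x \<in> \<Lambda>" "y \<in> \<Lambda>" for x y
  proof -
    have "w (\<phi> t z) = 0" if "z \<in> \<Lambda>" "t \<in> flow_dom \<Gamma> z" for t z
      using inv that w0 by (auto simp: flow_invariant_def)
    then have "fw.exit_dist x y = 0" "bw.exit_dist x y = 0"
      using that \<epsilon> by (auto intro!: fw.exit_dist_eq_0 bw.exit_dist_eq_0 simp: Gdom)
    then show ?thesis by (simp add: d_def)
  qed
  have refl: "d x x = 0" for x by (simp add: d_def fw.exit_dist_self bw.exit_dist_self)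
  have tri: "d x z \<le> d x y + d y z" for x y z
    using fw.exit_dist_triangle[of x z y] bw.exit_dist_triangle[of x z y] by (simp add: d_def)
  have "continuous_on (N \<times> N) (\<lambda>(x, y). d x y)"
    using continuous_on_add[OF fw.exit_dist_cont bw.exit_dist_cont, of "N \<times> N"]
    by (simp add: d_def case_prod_beta')
  moreover have "d x y = 0 \<longleftrightarrow> x = y \<or> x \<in> \<Lambda> \<and> y \<in> \<Lambda>" if "x \<in> N" "y \<in> N" for x y
    using eq[of x y] eq[of y x] zero refl sym that by metis
  ultimately have "catenary_pseudo_metric \<Gamma> \<phi> \<Lambda> N d"
    unfolding catenary_pseudo_metric_def pseudo_metric_on_def
    using isoN deriv deriv' refl sym tri by blast
  then show ?thesis by blast
qed

theorem mainTheorem8: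
  fixes \<Gamma> :: "(real \<times> 'a::metric_space) set"
    and \<phi> :: "real \<Rightarrow> 'a \<Rightarrow> 'a"
    and \<Lambda> :: "'a set"
  assumes "partial_flow \<Gamma> \<phi>"
    and "isolated_set \<Gamma> \<phi> \<Lambda>"
  shows "(\<exists>N d. catenary_pseudo_metric \<Gamma> \<phi> \<Lambda> N d)
       \<and> (\<forall>p. \<Lambda> = {p} \<longrightarrow> (\<exists>N d. catenary_metric \<Gamma> \<phi> \<Lambda> N d))"
proof -
  have pseudo: "\<exists>N d. catenary_pseudo_metric \<Gamma> \<phi> \<Lambda> N d"
  proof (cases "\<Lambda> = {}")
    case True
    have "0 \<in> flow_dom \<Gamma> x" for x using assms(1) by (simp add: partial_flow_def)
    \<comment> \<open>The empty neighbourhood isolates the empty set, since every orbit contains its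
      point at time 0.\<close>
    then have "catenary_pseudo_metric \<Gamma> \<phi> \<Lambda> {} (\<lambda>_ _. 0)"
      using True by (auto simp: catenary_pseudo_metric_def isolating_nbhd_def
          pseudo_metric_on_def has_flow_deriv_def)
    then show ?thesis by blast
  qed (use catenary_pseudo_metric_exists assms in blast)
  \<comment> \<open>Two points of a singleton coincide, so the exceptional case of distance zero
    disappears.\<close>
  moreover have "catenary_metric \<Gamma> \<phi> {p} N d" if "catenary_pseudo_metric \<Gamma> \<phi> {p} N d" for p N d
    using that by (auto simp: catenary_metric_def catenary_pseudo_metric_def)
  ultimately show ?thesis by metis
qed

end
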